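(* Let $F$ be an algebraically closed field, $d\ge 2$ an integer, and $l$ the smallest prime divisor of $d$. Let $D_d$ be the set of decomposable polynomials of degree exactly $d$ in $F[x]$, viewed as a subset of the affine space of polynomials of degree at most $d$ (via their $d+1$ coefficients). Then $D_d=\varnothing$ if $d$ is prime, and otherwise $\dim D_d=l+d/l$.
   Context: For $g,h\in F[x]$, $g\circ h=g(h)$. A polynomial $f$ is decomposable if $f=g\circ h$ with $\deg g\ge2$ and $\deg h\ge 2$. The set $D_d$ is the image of a morphism of varieties (composition), and its dimension is the dimension of its Zariski closure. *)

theory Defs
  imports "HOL-Computational_Algebra.Computational_Algebra" "HOL-Library.Extended_Nat"
begin

definition decomposable :: "'a::comm_ring_1 poly \<Rightarrow> bool" where
  "decomposable f \<longleftrightarrow> (\<exists>g h. degree g \<ge> 2 \<and> degree h \<ge> 2 \<and> f = pcompose g h)"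

definition decomp_set :: "nat \<Rightarrow> 'a::comm_ring_1 poly set" where
  "decomp_set d = {f. degree f = d \<and> decomposable f}"

text \<open>The affine space A^(n+1) of polynomials of degree at most n, with coordinates
  the coefficients coeff p 0, ..., coeff p n.  Polynomial (regular) functions on it are
  generated by constants and coordinate functions under + and *.\<close>
inductive_set poly_fun :: "nat \<Rightarrow> ('a::comm_ring_1 poly \<Rightarrow> 'a) set" for n :: nat where
  const: "(\<lambda>_. c) \<in> poly_fun n"
| var: "i \<le> n \<Longrightarrow> (\<lambda>p. coeff p i) \<in> poly_fun n"
| add: "f \<in> poly_fun n \<Longrightarrow> g \<in> poly_fun n \<Longrightarrow> (\<lambda>p. f p + g p) \<in> poly_fun n"
| mult: "f \<in> poly_fun n \<Longrightarrow> g \<in> poly_fun n \<Longrightarrow> (\<lambda>p. f p * g p) \<in> poly_fun n"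

definition affine_space :: "nat \<Rightarrow> 'a::comm_ring_1 poly set" where
  "affine_space n = {p. degree p \<le> n}"

definition zariski_closed :: "nat \<Rightarrow> 'a::comm_ring_1 poly set \<Rightarrow> bool" where
  "zariski_closed n S \<longleftrightarrow>
     (\<exists>P \<subseteq> poly_fun n. S = {p \<in> affine_space n. \<forall>f\<in>P. f p = 0})"

definition zariski_closure :: "nat \<Rightarrow> 'a::comm_ring_1 poly set \<Rightarrow> 'a poly set" where
  "zariski_closure n S = \<Inter>{C. zariski_closed n C \<and> S \<subseteq> C}"

definition zariski_irreducible :: "nat \<Rightarrow> 'a::comm_ring_1 poly set \<Rightarrow> bool" where
  "zariski_irreducible n S \<longleftrightarrow> zariski_closed n S \<and> S \<noteq> {} \<and>
     (\<forall>A B. zariski_closed n A \<and> zariski_closed n B \<and> S = A \<union> B \<longrightarrow> S = A \<or> S = B)"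

definition zariski_dim :: "nat \<Rightarrow> 'a::comm_ring_1 poly set \<Rightarrow> enat" where
  "zariski_dim n S = Sup {enat k | k. \<exists>C :: nat \<Rightarrow> 'a poly set.
      (\<forall>i\<le>k. zariski_irreducible n (C i)) \<and> (\<forall>i<k. C i \<subset> C (Suc i)) \<and>
      C k \<subseteq> zariski_closure n S}"

end

(* Upper bound.  Normalising the right component to be monic without constant term, D_d is
   covered by the images of affine spaces of dimension e + d/e, for the proper divisors e > 1
   of d, and e + d/e is largest for e = l.  In a chain C_0 < ... < C_k of irreducible closed
   subsets, functions u_i vanishing on C_i but not on C_(i+1) are algebraically independent
   on C_k, and counting monomials bounds their number by the number of parameters.

   Lower bound.  Let m = d/l.  The spaces {deg < k} for k <= m, followed by the sets
   {g o h : deg g <= j, deg h <= m} for j = 1, ..., l, have irreducible closures, because any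
   two points of one of these sets lie on a polynomial curve inside it.  The closures strictly
   increase, each being separated from the next by the vanishing of a single coefficient; no
   uniqueness of decompositions is needed, so wild characteristic causes no trouble.  Allowing
   deg g < l and deg h < m is harmless, as these degenerate points are limits along curves. *)
theory Submission
  imports Defs "HOL-Library.Function_Algebras" "HOL-Library.FuncSet"
begin

section \<open>Algebras of functions\<close>

text \<open>Used for three algebras: \<open>poly_fun n\<close>, the polynomial functions of one
  parameter, and those of \<open>r\<close> parameters. Closure of coefficients under composition is
  thus proved only once.\<close>

locale function_algebra =
  fixes R :: "('b \<Rightarrow> 'a::comm_ring_1) set"
  assumes const_mem: "(\<lambda>_. c) \<in> R"
    and add_mem: "f \<in> R \<Longrightarrow> g \<in> R \<Longrightarrow> (\<lambda>x. f x + g x) \<in> R"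
    and mult_mem: "f \<in> R \<Longrightarrow> g \<in> R \<Longrightarrow> (\<lambda>x. f x * g x) \<in> R"
begin

lemma sum_mem: "(\<And>i. i \<in> I \<Longrightarrow> f i \<in> R) \<Longrightarrow> (\<lambda>x. \<Sum>i\<in>I. f i x) \<in> R"
  by (induction I rule: infinite_finite_induct) (auto intro: const_mem add_mem)

lemma poly_fun_comp_mem:
  assumes "F \<in> poly_fun n" "\<And>i. (\<lambda>x. coeff (\<gamma> x) i) \<in> R"
  shows "(\<lambda>x. F (\<gamma> x)) \<in> R"
  using assms(1) by induction (auto intro: const_mem add_mem mult_mem assms(2))

lemma coeff_add_mem:
  assumes "\<And>i. (\<lambda>x. coeff (p x) i) \<in> R" "\<And>i. (\<lambda>x. coeff (q x) i) \<in> R"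
  shows "(\<lambda>x. coeff (p x + q x) i) \<in> R"
  using assms by (auto intro: add_mem)

lemma coeff_mult_mem:
  assumes "\<And>i. (\<lambda>x. coeff (p x) i) \<in> R" "\<And>i. (\<lambda>x. coeff (q x) i) \<in> R"
  shows "(\<lambda>x. coeff (p x * q x) i) \<in> R"
  unfolding coeff_mult by (intro sum_mem mult_mem assms)

lemma coeff_smult_mem:
  assumes "c \<in> R" "\<And>i. (\<lambda>x. coeff (p x) i) \<in> R"
  shows "(\<lambda>x. coeff (smult (c x) (p x)) i) \<in> R"
  using assms by (auto intro: mult_mem)

lemma coeff_power_mem:
  assumes "\<And>i. (\<lambda>x. coeff (p x) i) \<in> R"
  shows "(\<lambda>x. coeff (p x ^ k) i) \<in> R"
  by (induction k arbitrary: i) (auto intro: const_mem coeff_mult_mem assms)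

lemma coeff_sum_mem:
  assumes "\<And>j i. j \<in> J \<Longrightarrow> (\<lambda>x. coeff (p j x) i) \<in> R"
  shows "(\<lambda>x. coeff (\<Sum>j\<in>J. p j x) i) \<in> R"
  unfolding coeff_sum by (intro sum_mem assms)

end

text \<open>When \<open>g\<close> varies in a family, its degree may drop for special parameters, so
  the summation range must not depend on \<open>degree g\<close>.\<close>

lemma pcompose_as_sum_upto:
  fixes g h :: "'a::comm_ring_1 poly"
  assumes "degree g \<le> n"
  shows "pcompose g h = (\<Sum>i\<le>n. smult (coeff g i) (h ^ i))"
proof -
  have "pcompose g h = (\<Sum>i\<le>degree g. smult (coeff g i) (h ^ i))"
    by (simp add: pcompose_altdef poly_altdef degree_map_poly coeff_map_poly)
  also have "\<dots> = (\<Sum>i\<le>n. smult (coeff g i) (h ^ i))"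
    using assms by (intro sum.mono_neutral_left) (auto simp: coeff_eq_0)
  finally show ?thesis .
qed

lemma (in function_algebra) coeff_pcompose_mem:
  assumes "\<And>x. degree (g x) \<le> n"
    and "\<And>i. (\<lambda>x. coeff (g x) i) \<in> R" "\<And>i. (\<lambda>x. coeff (h x) i) \<in> R"
  shows "(\<lambda>x. coeff (pcompose (g x) (h x)) i) \<in> R"
  unfolding pcompose_as_sum_upto[OF assms(1)]
  by (intro coeff_sum_mem coeff_smult_mem coeff_power_mem assms)

lemma function_algebra_poly_fun: "function_algebra (poly_fun n)"
  by unfold_locales (auto intro: poly_fun.intros)

lemma poly_fun_power: "f \<in> poly_fun n \<Longrightarrow> (\<lambda>p. f p ^ k) \<in> poly_fun n"
  by (induction k) (auto intro: poly_fun.intros)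

lemma poly_fun_prod: "(\<And>i. i \<in> I \<Longrightarrow> f i \<in> poly_fun n) \<Longrightarrow> (\<lambda>p. \<Prod>i\<in>I. f i p) \<in> poly_fun n"
  by (induction I rule: infinite_finite_induct) (auto intro: poly_fun.intros)


section \<open>The Zariski topology\<close>

lemma zariski_closed_subset_affine: "zariski_closed n S \<Longrightarrow> S \<subseteq> affine_space n"
  by (auto simp: zariski_closed_def)

lemma zariski_closed_zero_set: "f \<in> poly_fun n \<Longrightarrow> zariski_closed n {p \<in> affine_space n. f p = 0}"
  unfolding zariski_closed_def by (rule exI[of _ "{f}"]) auto

lemma zariski_closed_Int:
  assumes "zariski_closed n A" "zariski_closed n B"
  shows "zariski_closed n (A \<inter> B)"
proof -
  obtain P Q where "P \<subseteq> poly_fun n" "A = {p \<in> affine_space n. \<forall>f\<in>P. f p = 0}"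
    "Q \<subseteq> poly_fun n" "B = {p \<in> affine_space n. \<forall>f\<in>Q. f p = 0}"
    using assms by (auto simp: zariski_closed_def)
  then show ?thesis
    unfolding zariski_closed_def by (intro exI[of _ "P \<union> Q"]) auto
qed

lemma zariski_closed_Un:
  fixes A B :: "'a::idom poly set"
  assumes "zariski_closed n A" "zariski_closed n B"
  shows "zariski_closed n (A \<union> B)"
proof -
  obtain P Q where P: "P \<subseteq> poly_fun n" "A = {p \<in> affine_space n. \<forall>f\<in>P. f p = 0}"
    and Q: "Q \<subseteq> poly_fun n" "B = {p \<in> affine_space n. \<forall>f\<in>Q. f p = 0}"
    using assms by (auto simp: zariski_closed_def)
  let ?PQ = "(\<lambda>(f, g) p. f p * g p) ` (P \<times> Q)"
  have "?PQ \<subseteq> poly_fun n"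
    using P(1) Q(1) by (auto intro: poly_fun.mult)
  moreover have "A \<union> B = {p \<in> affine_space n. \<forall>f\<in>?PQ. f p = 0}"
    unfolding P(2) Q(2) by auto
  ultimately show ?thesis
    unfolding zariski_closed_def by blast
qed

lemma zariski_closed_empty: "zariski_closed n ({} :: 'a::comm_ring_1 poly set)"
  unfolding zariski_closed_def
  by (rule exI[of _ "{\<lambda>_. 1}"]) (auto intro: poly_fun.const)

lemma zariski_closed_UN:
  fixes A :: "'i \<Rightarrow> 'a::idom poly set"
  assumes "finite I" "\<And>i. i \<in> I \<Longrightarrow> zariski_closed n (A i)"
  shows "zariski_closed n (\<Union>i\<in>I. A i)"
  using assms by (induction I) (auto intro: zariski_closed_Un zariski_closed_empty)

lemma subset_zariski_closure: "S \<subseteq> zariski_closure n S"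
  by (auto simp: zariski_closure_def)

lemma zariski_closure_minimal: "zariski_closed n C \<Longrightarrow> S \<subseteq> C \<Longrightarrow> zariski_closure n S \<subseteq> C"
  by (auto simp: zariski_closure_def)

lemma zariski_closure_subset_closure:
  "S \<subseteq> zariski_closure n T \<Longrightarrow> zariski_closure n S \<subseteq> zariski_closure n T"
  unfolding zariski_closure_def by blast

lemma zariski_closure_eq:
  assumes "S \<subseteq> affine_space n"
  shows "zariski_closure n S =
    {p \<in> affine_space n. \<forall>f\<in>poly_fun n. (\<forall>s\<in>S. f s = 0) \<longrightarrow> f p = 0}" (is "_ = ?Z")
proof
  have "zariski_closed n ?Z"
    unfolding zariski_closed_def
    by (rule exI[of _ "{f \<in> poly_fun n. \<forall>s\<in>S. f s = 0}"]) auto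
  then show "zariski_closure n S \<subseteq> ?Z"
    using assms by (intro zariski_closure_minimal) auto
  show "?Z \<subseteq> zariski_closure n S"
    unfolding zariski_closure_def by (auto simp: zariski_closed_def subset_iff)
qed

lemma zariski_closed_closure:
  assumes "S \<subseteq> affine_space n"
  shows "zariski_closed n (zariski_closure n S)"
  unfolding zariski_closure_eq[OF assms] zariski_closed_def
  by (rule exI[of _ "{f \<in> poly_fun n. \<forall>s\<in>S. f s = 0}"]) auto

lemma zariski_closed_separate:
  assumes "zariski_closed n A" "p \<in> affine_space n" "p \<notin> A"
  obtains f where "f \<in> poly_fun n" "\<And>a. a \<in> A \<Longrightarrow> f a = 0" "f p \<noteq> 0"
  using assms unfolding zariski_closed_def by blast

text \<open>Irreducibility splits off one piece at a time. This will put the top of a chain into the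
  closure of a single parametrised family.\<close>

lemma zariski_irreducible_UN:
  fixes A :: "'i \<Rightarrow> 'a::idom poly set"
  assumes "zariski_irreducible n C" "finite I" "\<And>i. i \<in> I \<Longrightarrow> zariski_closed n (A i)"
    and "C \<subseteq> (\<Union>i\<in>I. A i)"
  obtains i where "i \<in> I" "C \<subseteq> A i"
proof -
  have "\<exists>i\<in>I. C \<subseteq> A i"
    using assms(2,3,4)
  proof (induction I)
    case empty
    then show ?case using assms(1) by (auto simp: zariski_irreducible_def)
  next
    case (insert i I)
    let ?U = "C \<inter> A i" and ?V = "C \<inter> (\<Union>i\<in>I. A i)"
    have "zariski_closed n ?U" "zariski_closed n ?V"
      using insert assms(1)
      by (auto intro!: zariski_closed_Int zariski_closed_UN simp: zariski_irreducible_def)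
    moreover have "C = ?U \<union> ?V"
      using insert.prems(2) by auto
    ultimately have "C = ?U \<or> C = ?V"
      using assms(1) unfolding zariski_irreducible_def by blast
    then show ?case
    proof
      assume "C = ?U"
      then show ?thesis by blast
    next
      assume "C = ?V"
      then have "\<exists>i\<in>I. C \<subseteq> A i"
        using insert.prems(1) by (intro insert.IH) auto
      then show ?thesis by blast
    qed
  qed
  then show ?thesis using that by blast
qed

text \<open>The vanishing ideal of an irreducible set is prime, because the zero sets of the two
  factors cover \<open>C\<close>.\<close>

lemma zariski_irreducible_mult_eq_0:
  fixes C :: "'a::idom poly set"
  assumes C: "zariski_irreducible n C" and fg: "f \<in> poly_fun n" "g \<in> poly_fun n"
    and "\<And>p. p \<in> C \<Longrightarrow> f p * g p = 0"
  shows "(\<forall>p\<in>C. f p = 0) \<or> (\<forall>p\<in>C. g p = 0)"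
proof -
  let ?U = "C \<inter> {p \<in> affine_space n. f p = 0}" and ?V = "C \<inter> {p \<in> affine_space n. g p = 0}"
  have "zariski_closed n ?U" "zariski_closed n ?V"
    using C fg by (auto intro!: zariski_closed_Int zariski_closed_zero_set simp: zariski_irreducible_def)
  moreover have "C = ?U \<union> ?V"
    using assms zariski_closed_subset_affine[of n C] by (auto simp: zariski_irreducible_def)
  ultimately have "C = ?U \<or> C = ?V"
    using C unfolding zariski_irreducible_def by blast
  then show ?thesis by blast
qed


section \<open>Polynomial curves and irreducibility\<close>

definition poly_curve :: "('a::comm_ring_1 \<Rightarrow> 'a poly) \<Rightarrow> bool" where
  "poly_curve \<gamma> \<longleftrightarrow> (\<forall>i. (\<lambda>t. coeff (\<gamma> t) i) \<in> range poly)"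

lemma function_algebra_range_poly: "function_algebra (range (poly :: 'a::comm_ring_1 poly \<Rightarrow> _))"
proof unfold_locales
  show "(\<lambda>_. c) \<in> range poly" for c :: 'a
    by (rule range_eqI[of _ _ "[:c:]"]) auto
  show "(\<lambda>x. f x + g x) \<in> range poly" if "f \<in> range poly" "g \<in> range poly" for f g :: "'a \<Rightarrow> 'a"
    using that by (auto simp flip: poly_add)
  show "(\<lambda>x. f x * g x) \<in> range poly" if "f \<in> range poly" "g \<in> range poly" for f g :: "'a \<Rightarrow> 'a"
    using that by (auto simp flip: poly_mult)
qed

lemma poly_curve_poly_fun:
  assumes "poly_curve \<gamma>" "F \<in> poly_fun n"
  obtains q where "\<And>t. F (\<gamma> t) = poly q t"
proof -
  have "(\<lambda>t. F (\<gamma> t)) \<in> range poly"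
    using assms(1) unfolding poly_curve_def
    by (intro function_algebra.poly_fun_comp_mem[OF function_algebra_range_poly assms(2)]) blast
  then obtain q where "(\<lambda>t. F (\<gamma> t)) = poly q" by blast
  then show ?thesis by (intro that) (rule fun_cong)
qed

lemma poly_curve_line: "poly_curve (\<lambda>t. p + smult t q)"
proof -
  have "(\<lambda>t. coeff (p + smult t q) i) = poly [:coeff p i, coeff q i:]" for i
    by (auto simp: fun_eq_iff)
  then show ?thesis by (auto simp: poly_curve_def)
qed

lemma poly_curve_pcompose:
  assumes "poly_curve g" "poly_curve h" "\<And>t. degree (g t) \<le> n"
  shows "poly_curve (\<lambda>t. pcompose (g t) (h t))"
  using assms function_algebra.coeff_pcompose_mem[OF function_algebra_range_poly, of g n h]
  by (auto simp: poly_curve_def)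

text \<open>A finite \<open>E\<close> allows for curves that degenerate at finitely many
  parameters.\<close>

lemma poly_eq_0_if_cofinitely_zero:
  fixes q :: "'a::idom poly"
  assumes "infinite (UNIV :: 'a set)" "finite E" "\<And>t. t \<notin> E \<Longrightarrow> poly q t = 0"
  shows "q = 0"
proof (rule ccontr)
  assume "q \<noteq> 0"
  then have "finite (E \<union> {t. poly q t = 0})"
    using assms(2) poly_roots_finite by auto
  moreover have "E \<union> {t. poly q t = 0} = UNIV"
    using assms(3) by auto
  ultimately show False using assms(1) by simp
qed

text \<open>If closed \<open>A\<close> and \<open>B\<close> cover the closure but neither contains
  \<open>W\<close>, functions separating them from points \<open>v\<close> and \<open>w\<close> pull
  back along a curve through both points to nonzero polynomials with product zero.\<close>

lemma zariski_irreducible_closure: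
  fixes W :: "'a::idom poly set"
  assumes inf: "infinite (UNIV :: 'a set)"
    and W: "W \<subseteq> affine_space n" "W \<noteq> {}"
    and curve: "\<And>v w. v \<in> W \<Longrightarrow> w \<in> W \<Longrightarrow>
      \<exists>\<gamma>. poly_curve \<gamma> \<and> \<gamma> 0 = v \<and> \<gamma> 1 = w \<and> (\<forall>t. \<gamma> t \<in> W)"
  shows "zariski_irreducible n (zariski_closure n W)"
  unfolding zariski_irreducible_def
proof (intro conjI allI impI)
  show "zariski_closed n (zariski_closure n W)"
    using W(1) by (rule zariski_closed_closure)
  show "zariski_closure n W \<noteq> {}"
    using W(2) subset_zariski_closure[of W n] by auto
  fix A B
  assume AB: "zariski_closed n A \<and> zariski_closed n B \<and> zariski_closure n W = A \<union> B"
  show "zariski_closure n W = A \<or> zariski_closure n W = B"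
  proof (rule ccontr)
    assume "\<not> ?thesis"
    then have "\<not> W \<subseteq> A" "\<not> W \<subseteq> B"
      using AB zariski_closure_minimal[of n A W] zariski_closure_minimal[of n B W] by auto
    then obtain v w where v: "v \<in> W" "v \<notin> A" and w: "w \<in> W" "w \<notin> B" by blast
    obtain F where F: "F \<in> poly_fun n" "\<And>a. a \<in> A \<Longrightarrow> F a = 0" "F v \<noteq> 0"
      using zariski_closed_separate[of n A v] AB v W(1) by blast
    obtain G where G: "G \<in> poly_fun n" "\<And>a. a \<in> B \<Longrightarrow> G a = 0" "G w \<noteq> 0"
      using zariski_closed_separate[of n B w] AB w W(1) by blast
    obtain \<gamma> where \<gamma>: "poly_curve \<gamma>" "\<gamma> 0 = v" "\<gamma> 1 = w" "\<And>t. \<gamma> t \<in> W"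
      using curve[OF v(1) w(1)] by blast
    obtain f where f: "\<And>t. F (\<gamma> t) = poly f t" using poly_curve_poly_fun[OF \<gamma>(1) F(1)] by blast
    obtain g where g: "\<And>t. G (\<gamma> t) = poly g t" using poly_curve_poly_fun[OF \<gamma>(1) G(1)] by blast
    have "poly (f * g) t = 0" for t
    proof -
      have "\<gamma> t \<in> A \<union> B" using \<gamma>(4)[of t] AB subset_zariski_closure[of W n] by auto
      then show ?thesis using F(2) G(2) f[of t] g[of t] by auto
    qed
    then have "f * g = 0" by (intro poly_eq_0_if_cofinitely_zero[OF inf finite.emptyI]) auto
    moreover have "f \<noteq> 0" "g \<noteq> 0"
      using F(3) G(3) f[of 0] g[of 1] \<gamma>(2,3) by auto
    ultimately show False by simp
  qed
qed

text \<open>As in Euclid's argument: over a finite field, 1 plus the product of all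
  \<open>[:- a, 1:]\<close> would have no root.\<close>

lemma alg_closed_field_infinite: "infinite (UNIV :: 'a::alg_closed_field set)"
proof
  assume fin: "finite (UNIV :: 'a set)"
  define p :: "'a poly" where "p = (\<Prod>a\<in>UNIV. [:- a, 1:])"
  have "degree p = (\<Sum>a\<in>(UNIV :: 'a set). degree [:- a, 1:])"
    unfolding p_def by (rule degree_prod_eq_sum_degree) simp
  also have "\<dots> = card (UNIV :: 'a set)" by simp
  finally have "degree p > 0" using fin by (simp add: card_gt_0_iff)
  then have "degree (p + 1) > 0" by (simp add: degree_add_eq_left)
  then obtain x where "poly (p + 1) x = 0"
    using alg_closed_imp_poly_has_root by blast
  moreover have "poly p x = 0"
    unfolding p_def poly_prod using fin by (rule prod_zero) (rule bexI[of _ x], simp_all)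
  ultimately show False by simp
qed


section \<open>Monomials and algebraic independence\<close>

text \<open>Extensional functions make the set finite, and bounding each exponent separately makes
  it a box with \<open>Suc N ^ r\<close> elements.\<close>

definition exponents :: "nat \<Rightarrow> nat \<Rightarrow> (nat \<Rightarrow> nat) set" where
  "exponents r N = PiE {..<r} (\<lambda>_. {..N})"

text \<open>The \<open>u i\<close> will be either regular functions separating a chain or the
  coordinates of the parameter space.\<close>

definition monom_fun :: "nat \<Rightarrow> (nat \<Rightarrow> 'b \<Rightarrow> 'a::comm_ring_1) \<Rightarrow> (nat \<Rightarrow> nat) \<Rightarrow> 'b \<Rightarrow> 'a" where
  "monom_fun r u \<alpha> x = (\<Prod>i<r. u i x ^ \<alpha> i)"

lemma finite_exponents: "finite (exponents r N)"
  by (auto simp: exponents_def intro: finite_PiE)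

lemma card_exponents: "card (exponents r N) = Suc N ^ r"
  by (simp add: exponents_def card_funcsetE)

lemma monom_fun_Suc_upd: "monom_fun (Suc r) u (\<alpha>(r := k)) x = u r x ^ k * monom_fun r u \<alpha> x"
  by (simp add: monom_fun_def mult.commute)

lemma exponents_Suc:
  "exponents (Suc r) N = (\<lambda>(k, \<alpha>). \<alpha>(r := k)) ` ({..N} \<times> exponents r N)"
  unfolding exponents_def lessThan_Suc PiE_insert_eq by simp

lemma sum_exponents_Suc:
  "(\<Sum>\<alpha>\<in>exponents (Suc r) N. f \<alpha>) = (\<Sum>k\<le>N. \<Sum>\<alpha>\<in>exponents r N. f (\<alpha>(r := k)))"
proof -
  have inj: "inj_on (\<lambda>(k, \<alpha>). \<alpha>(r := k)) ({..N} \<times> exponents r N)"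
    unfolding exponents_def by (rule inj_combinator) simp
  show ?thesis
    unfolding exponents_Suc sum.reindex[OF inj] by (simp add: sum.cartesian_product split_beta)
qed

text \<open>The relation of lowest order in the last variable, divided by a power of that variable,
  restricts to a relation among the remaining variables on the smaller set.\<close>
lemma chain_monomials_independent:
  fixes C :: "nat \<Rightarrow> 'a::idom poly set"
  assumes irr: "\<And>i. i \<le> k \<Longrightarrow> zariski_irreducible n (C i)"
    and sub: "\<And>i. i < k \<Longrightarrow> C i \<subseteq> C (Suc i)"
    and u: "\<And>i. i < k \<Longrightarrow> u i \<in> poly_fun n"
    and u0: "\<And>i p. i < k \<Longrightarrow> p \<in> C i \<Longrightarrow> u i p = 0"
    and u1: "\<And>i. i < k \<Longrightarrow> \<exists>p\<in>C (Suc i). u i p \<noteq> 0"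
    and "j \<le> k"
    and "\<And>p. p \<in> C j \<Longrightarrow> (\<Sum>\<alpha>\<in>exponents j N. c \<alpha> * monom_fun j u \<alpha> p) = 0"
    and "\<alpha> \<in> exponents j N"
  shows "c \<alpha> = 0"
  using assms(6-)
proof (induction j arbitrary: c \<alpha>)
  case 0
  \<comment> \<open>Only the empty monomial occurs, so the relation is a constant that vanishes at a
    point of \<open>C 0\<close>.\<close>
  obtain p where "p \<in> C 0" using irr[of 0] by (auto simp: zariski_irreducible_def)
  have "exponents 0 N = {\<lambda>_. undefined}"
    by (simp add: exponents_def)
  then have "\<alpha> = (\<lambda>_. undefined)" "c (\<lambda>_. undefined) * monom_fun 0 u (\<lambda>_. undefined) p = 0"
    using 0(2)[OF \<open>p \<in> C 0\<close>] 0(3) by simp_all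
  then show ?case by (simp add: monom_fun_def)
next
  case (Suc j)
  \<comment> \<open>\<open>P i\<close> is the coefficient of the \<open>i\<close>-th power of
    \<open>u j\<close> in the relation.\<close>
  define P where "P i p = (\<Sum>\<beta>\<in>exponents j N. c (\<beta>(j := i)) * monom_fun j u \<beta> p)" for i p
  have P_mem: "P i \<in> poly_fun n" for i
  proof -
    have "(\<lambda>p. c (\<beta>(j := i)) * monom_fun j u \<beta> p) \<in> poly_fun n" for \<beta>
      unfolding monom_fun_def using Suc.prems(1) u
      by (intro poly_fun.mult poly_fun.const poly_fun_prod poly_fun_power) auto
    then show ?thesis
      unfolding P_def by (intro function_algebra.sum_mem[OF function_algebra_poly_fun])
  qed
  have expand: "(\<Sum>i\<le>N. u j p ^ i * P i p) = 0" if "p \<in> C (Suc j)" for p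
    using Suc.prems(2)[OF that]
    by (simp add: sum_exponents_Suc P_def monom_fun_Suc_upd sum_distrib_left mult_ac)
  have "\<forall>\<beta>\<in>exponents j N. c (\<beta>(j := i)) = 0" if "i \<le> N" for i
    using that
  proof (induction i rule: less_induct)
    case (less i)
    have P_less: "P m p = 0" if "m < i" for m p
    proof -
      have "\<forall>\<beta>\<in>exponents j N. c (\<beta>(j := m)) = 0"
        by (rule less.IH) (use less.prems that in auto)
      then show ?thesis
        unfolding P_def by (intro sum.neutral) (simp del: fun_upd_apply)
    qed
    define G where "G p = (\<Sum>m\<in>{i..N}. u j p ^ (m - i) * P m p)" for p
    have G_mem: "G \<in> poly_fun n"
      unfolding G_def using Suc.prems(1) u
      by (intro function_algebra.sum_mem[OF function_algebra_poly_fun] poly_fun.mult poly_fun_power P_mem) auto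
    have "u j p ^ i * G p = 0" if p: "p \<in> C (Suc j)" for p
    proof -
      have "u j p ^ i * G p = (\<Sum>m\<in>{i..N}. u j p ^ m * P m p)"
        unfolding G_def sum_distrib_left
        by (intro sum.cong) (auto simp flip: power_add simp: mult.assoc[symmetric])
      also have "\<dots> = (\<Sum>m\<le>N. u j p ^ m * P m p)"
        using P_less by (intro sum.mono_neutral_left) auto
      finally show ?thesis using expand[OF p] by simp
    qed
    \<comment> \<open>Since \<open>u j\<close> does not vanish identically on the irreducible set
      \<open>C (Suc j)\<close>, its power can be cancelled.\<close>
    then have "(\<forall>p\<in>C (Suc j). u j p ^ i = 0) \<or> (\<forall>p\<in>C (Suc j). G p = 0)"
      using irr[of "Suc j"] u[of j] Suc.prems(1) G_mem
      by (intro zariski_irreducible_mult_eq_0[of n]) (auto intro: poly_fun_power)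
    then have G0: "G p = 0" if "p \<in> C (Suc j)" for p
      using u1[of j] Suc.prems(1) that by auto
    \<comment> \<open>On \<open>C j\<close> every term of \<open>G\<close> except
      \<open>m = i\<close> contains a factor \<open>u j\<close> and vanishes.\<close>
    have "P i p = 0" if p: "p \<in> C j" for p
    proof -
      have "u j p = 0" "p \<in> C (Suc j)"
        using p u0[of j p] sub[of j] Suc.prems(1) by auto
      have "G p = P i p + (\<Sum>m\<in>{Suc i..N}. u j p ^ (m - i) * P m p)"
        unfolding G_def using less.prems by (simp add: sum.atLeast_Suc_atMost)
      also have "(\<Sum>m\<in>{Suc i..N}. u j p ^ (m - i) * P m p) = 0"
        using \<open>u j p = 0\<close> by (intro sum.neutral) (auto simp: power_0_left)
      finally show ?thesis using G0[OF \<open>p \<in> C (Suc j)\<close>] by simp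
    qed
    then have "c (\<beta>(j := i)) = 0" if "\<beta> \<in> exponents j N" for \<beta>
      using that Suc.prems(1) by (intro Suc.IH[of "\<lambda>\<beta>. c (\<beta>(j := i))"]) (auto simp: P_def)
    then show ?case by blast
  qed
  moreover obtain i \<beta> where "\<alpha> = \<beta>(j := i)" "i \<le> N" "\<beta> \<in> exponents j N"
    using Suc.prems(3) unfolding exponents_Suc by auto
  ultimately show ?case by blast
qed

interpretation fun_vs: vector_space "\<lambda>(c::'a::field) (f::'b \<Rightarrow> 'a) x. c * f x"
  by unfold_locales (auto simp: fun_eq_iff algebra_simps)

text \<open>The relation is indexed by \<open>I\<close> and not by the image of \<open>v\<close>, so
  a repeated value already yields one. If \<open>v\<close> is injective, more than
  \<open>card T\<close> vectors in the span of \<open>T\<close> are dependent.\<close>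

lemma exists_linear_relation:
  fixes v :: "'i \<Rightarrow> 'b \<Rightarrow> 'a::field"
  assumes "finite I" "finite T" "\<And>i. i \<in> I \<Longrightarrow> v i \<in> fun_vs.span T" "card T < card I"
  obtains c where "\<exists>i\<in>I. c i \<noteq> 0" "\<And>x. (\<Sum>i\<in>I. c i * v i x) = 0"
proof (cases "inj_on v I")
  case True
  have "fun_vs.dependent (v ` I)"
  proof (rule ccontr)
    assume "\<not> ?thesis"
    then have "card (v ` I) \<le> card T"
      using assms by (intro conjunct2[OF fun_vs.independent_span_bound]) auto
    then show False using assms(4) True by (simp add: card_image)
  qed
  then obtain a w where a: "w \<in> v ` I" "a w \<noteq> 0" "(\<Sum>f\<in>v ` I. (\<lambda>x. a f * f x)) = 0"
    using fun_vs.dependent_finite[of "v ` I"] assms(1) by auto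
  have sum_apply: "(\<Sum>f\<in>A. g f) x = (\<Sum>f\<in>A. g f x)" for A and g :: "('b \<Rightarrow> 'a) \<Rightarrow> 'b \<Rightarrow> 'a" and x
    by (induction A rule: infinite_finite_induct) auto
  show ?thesis
  proof
    show "\<exists>i\<in>I. (a \<circ> v) i \<noteq> 0" using a(1,2) by auto
    show "(\<Sum>i\<in>I. (a \<circ> v) i * v i x) = 0" for x
    proof -
      have "(\<Sum>f\<in>v ` I. a f * f x) = 0"
        using fun_cong[OF a(3), of x] by (simp only: sum_apply zero_fun_apply)
      then show ?thesis using True by (simp add: sum.reindex)
    qed
  qed
next
  case False
  then obtain i j where ij: "i \<in> I" "j \<in> I" "i \<noteq> j" "v i = v j" by (auto simp: inj_on_def)
  define c :: "'i \<Rightarrow> 'a" where "c m = (if m = i then 1 else if m = j then -1 else 0)" for m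
  show ?thesis
  proof
    show "\<exists>m\<in>I. c m \<noteq> 0" using ij by (auto simp: c_def)
    show "(\<Sum>m\<in>I. c m * v m x) = 0" for x
    proof -
      have "(\<Sum>m\<in>I. c m * v m x) = (\<Sum>m\<in>{i, j}. c m * v m x)"
        using ij assms(1) by (intro sum.mono_neutral_right) (auto simp: c_def)
      then show ?thesis using ij by (simp add: c_def)
    qed
  qed
qed


section \<open>The dimension of a polynomial image\<close>

text \<open>Polynomial functions of \<open>r\<close> parameters; the degree bound applies to each
  variable separately, not to the total degree.\<close>

definition bounded_polys :: "nat \<Rightarrow> nat \<Rightarrow> ((nat \<Rightarrow> 'a::field) \<Rightarrow> 'a) set" where
  "bounded_polys r N = fun_vs.span (monom_fun r (\<lambda>i t. t i) ` exponents r N)"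

lemma bounded_polys_mono: "N \<le> M \<Longrightarrow> bounded_polys r N \<subseteq> bounded_polys r M"
  unfolding bounded_polys_def exponents_def
  by (intro fun_vs.span_mono image_mono PiE_mono) auto

lemma bounded_polys_add:
  "f \<in> bounded_polys r N \<Longrightarrow> g \<in> bounded_polys r N \<Longrightarrow> (\<lambda>t. f t + g t) \<in> bounded_polys r N"
  using fun_vs.span_add[of f _ g] by (simp add: bounded_polys_def plus_fun_def)

lemma bounded_polys_scale:
  "f \<in> bounded_polys r N \<Longrightarrow> (\<lambda>t. c * f t) \<in> bounded_polys r N"
  using fun_vs.span_scale[of f _ c] by (simp add: bounded_polys_def)

lemma zero_mem_bounded_polys: "(\<lambda>_. 0) \<in> bounded_polys r N"
  using fun_vs.span_zero by (simp add: bounded_polys_def zero_fun_def)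

lemma monom_fun_mem_bounded_polys:
  assumes "\<And>i. i < r \<Longrightarrow> \<alpha> i \<le> N"
  shows "monom_fun r (\<lambda>i t. t i) \<alpha> \<in> bounded_polys r N"
proof -
  have "monom_fun r (\<lambda>i t. t i) \<alpha> = (monom_fun r (\<lambda>i t. t i) (restrict \<alpha> {..<r}) :: _ \<Rightarrow> 'a)"
    by (auto simp: monom_fun_def fun_eq_iff)
  moreover have "restrict \<alpha> {..<r} \<in> exponents r N"
    using assms by (auto simp: exponents_def)
  ultimately show ?thesis
    unfolding bounded_polys_def by (auto intro!: fun_vs.span_base)
qed

lemma const_mem_bounded_polys: "(\<lambda>_. c) \<in> bounded_polys r N"
  using bounded_polys_scale[OF monom_fun_mem_bounded_polys[of r "\<lambda>_. 0" N], of c]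
  by (simp add: monom_fun_def)

lemma coordinate_mem_bounded_polys:
  assumes "i < r"
  shows "(\<lambda>t. t i) \<in> bounded_polys r 1"
proof -
  have "monom_fun r (\<lambda>i t. t i) (\<lambda>j. if j = i then 1 else 0) = (\<lambda>t. t i :: 'a)"
    using assms by (auto simp: monom_fun_def fun_eq_iff if_distrib[of "\<lambda>k. _ ^ k"] prod.delta cong: if_cong)
  then show ?thesis
    by (subst (asm) eq_commute) (simp add: monom_fun_mem_bounded_polys)
qed

lemma bounded_polys_induct [consumes 1, case_names zero step]:
  assumes "f \<in> bounded_polys r N" "P (\<lambda>_. 0)"
    and "\<And>c \<alpha> g. \<alpha> \<in> exponents r N \<Longrightarrow> P g \<Longrightarrow> P (\<lambda>t. c * monom_fun r (\<lambda>i t. t i) \<alpha> t + g t)"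
  shows "P f"
  using assms(1) unfolding bounded_polys_def
proof (induction rule: fun_vs.span_induct_alt)
  case base
  then show ?case using assms(2) by (simp add: zero_fun_def)
next
  case (step c x y)
  then show ?case using assms(3)[of _ y c] by (auto simp: plus_fun_def)
qed

lemma bounded_polys_mult:
  assumes "f \<in> bounded_polys r N" "g \<in> bounded_polys r M"
  shows "(\<lambda>t. f t * g t) \<in> bounded_polys r (N + M)"
  using assms(1)
proof (induction rule: bounded_polys_induct)
  case zero
  then show ?case by (simp add: zero_mem_bounded_polys)
next
  case (step c \<alpha> f)
  have "(\<lambda>t. monom_fun r (\<lambda>i t. t i) \<alpha> t * g t) \<in> bounded_polys r (N + M)"
    using assms(2)
  proof (induction rule: bounded_polys_induct)
    case zero
    then show ?case by (simp add: zero_mem_bounded_polys)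
  next
    case (step c \<beta> g)
    have "monom_fun r (\<lambda>i t. t i) (\<lambda>i. \<alpha> i + \<beta> i) \<in> (bounded_polys r (N + M) :: (_ \<Rightarrow> 'a) set)"
      using step(1) \<open>\<alpha> \<in> exponents r N\<close>
      by (intro monom_fun_mem_bounded_polys add_mono) (auto simp: exponents_def)
    from bounded_polys_add[OF bounded_polys_scale[OF this, of c] step(2)]
    show ?case by (simp add: monom_fun_def power_add prod.distrib algebra_simps)
  qed
  from bounded_polys_add[OF bounded_polys_scale[OF this, of c] step(2)]
  show ?case by (simp add: algebra_simps)
qed

lemma bounded_polys_power:
  "f \<in> bounded_polys r N \<Longrightarrow> (\<lambda>t. f t ^ k) \<in> bounded_polys r (k * N)"
  by (induction k) (auto simp: const_mem_bounded_polys bounded_polys_mult)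

lemma bounded_polys_prod:
  assumes "\<And>i. i < k \<Longrightarrow> f i \<in> bounded_polys r N"
  shows "(\<lambda>t. \<Prod>i<k. f i t) \<in> bounded_polys r (k * N)"
  using assms
proof (induction k)
  case (Suc k)
  then show ?case
    using bounded_polys_mult[of "\<lambda>t. \<Prod>i<k. f i t" r "k * N" "f k" N]
    by (simp add: add.commute)
qed (simp add: const_mem_bounded_polys)

lemma function_algebra_bounded_polys:
  "function_algebra (\<Union>N. bounded_polys r N :: ((nat \<Rightarrow> 'a::field) \<Rightarrow> 'a) set)"
proof unfold_locales
  show "(\<lambda>_. c) \<in> (\<Union>N. bounded_polys r N)" for c :: 'a
    using const_mem_bounded_polys by blast
  fix f g :: "(nat \<Rightarrow> 'a) \<Rightarrow> 'a"
  assume "f \<in> (\<Union>N. bounded_polys r N)" "g \<in> (\<Union>N. bounded_polys r N)"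
  then obtain N M where NM: "f \<in> bounded_polys r N" "g \<in> bounded_polys r M" by auto
  then show "(\<lambda>x. f x * g x) \<in> (\<Union>N. bounded_polys r N)"
    using bounded_polys_mult by blast
  have "f \<in> bounded_polys r (max N M)" "g \<in> bounded_polys r (max N M)"
    using NM bounded_polys_mono[of N "max N M" r] bounded_polys_mono[of M "max N M" r] by auto
  then show "(\<lambda>x. f x + g x) \<in> (\<Union>N. bounded_polys r N)"
    using bounded_polys_add by blast
qed

text \<open>If \<^term>\<open>k > r\<close>, then for large \<^term>\<open>N\<close> the \<^term>\<open>(N + 1) ^ k\<close> monomials in the functions
  separating the members of the chain outnumber the monomials in the \<^term>\<open>r\<close> parameters
  that span their pullbacks.\<close>
lemma irreducible_chain_length_le:
  fixes C :: "nat \<Rightarrow> 'a::field poly set" and \<phi> :: "(nat \<Rightarrow> 'a) \<Rightarrow> 'a poly"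
  assumes irr: "\<And>i. i \<le> k \<Longrightarrow> zariski_irreducible n (C i)"
    and sub: "\<And>i. i < k \<Longrightarrow> C i \<subset> C (Suc i)"
    and Ck: "C k \<subseteq> zariski_closure n (range \<phi>)" and \<phi>: "range \<phi> \<subseteq> affine_space n"
    and coeff: "\<And>i. (\<lambda>t. coeff (\<phi> t) i) \<in> (\<Union>N. bounded_polys r N)"
  shows "k \<le> r"
proof (rule ccontr)
  assume "\<not> k \<le> r"
  then have "r < k" by simp
  have "\<exists>f\<in>poly_fun n. (\<forall>p\<in>C i. f p = 0) \<and> (\<exists>p\<in>C (Suc i). f p \<noteq> 0)" if i: "i < k" for i
  proof -
    obtain p where p: "p \<in> C (Suc i)" "p \<notin> C i" using sub[OF i] by blast
    have "zariski_closed n (C i)" "p \<in> affine_space n"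
      using irr[of i] irr[of "Suc i"] i p(1) zariski_closed_subset_affine[of n "C (Suc i)"]
      by (auto simp: zariski_irreducible_def)
    then show ?thesis using zariski_closed_separate[of n "C i" p] p by metis
  qed
  then obtain u where u: "\<And>i. i < k \<Longrightarrow> u i \<in> poly_fun n"
    "\<And>i p. i < k \<Longrightarrow> p \<in> C i \<Longrightarrow> u i p = 0" "\<And>i. i < k \<Longrightarrow> \<exists>p\<in>C (Suc i). u i p \<noteq> 0"
    by metis
  have "\<exists>D. (\<lambda>t. u i (\<phi> t)) \<in> bounded_polys r D" if "i < k" for i
    using function_algebra.poly_fun_comp_mem[OF function_algebra_bounded_polys u(1)[OF that] coeff]
    by auto
  then obtain D0 where D0: "\<And>i. i < k \<Longrightarrow> (\<lambda>t. u i (\<phi> t)) \<in> bounded_polys r (D0 i)"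
    by metis
  \<comment> \<open>The sum serves as a common upper bound for the \<open>D0 i\<close>.\<close>
  define D where "D = (\<Sum>i<k. D0 i)"
  have D: "(\<lambda>t. u i (\<phi> t)) \<in> bounded_polys r D" if "i < k" for i
    using D0[OF that] bounded_polys_mono[of "D0 i" D r] that
    by (auto simp: D_def intro!: member_le_sum)
  \<comment> \<open>Chosen so that \<open>(Suc (k * D) * Suc N) ^ r = N * Suc N ^ r\<close>, which
    is less than \<open>Suc N ^ Suc r\<close>.\<close>
  define N where "N = Suc (k * D) ^ r"
  define T :: "((nat \<Rightarrow> 'a) \<Rightarrow> 'a) set" where
    "T = monom_fun r (\<lambda>i t. t i) ` exponents r (k * (N * D))"
  have mem: "(\<lambda>t. monom_fun k u \<alpha> (\<phi> t)) \<in> fun_vs.span T" if \<alpha>: "\<alpha> \<in> exponents k N" for \<alpha>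
  proof -
    have "(\<lambda>t. u i (\<phi> t) ^ \<alpha> i) \<in> bounded_polys r (N * D)" if "i < k" for i
    proof -
      have "\<alpha> i * D \<le> N * D" using \<alpha> that by (auto simp: exponents_def)
      then show ?thesis using bounded_polys_power[OF D[OF that]] bounded_polys_mono by blast
    qed
    then have "(\<lambda>t. \<Prod>i<k. u i (\<phi> t) ^ \<alpha> i) \<in> bounded_polys r (k * (N * D))"
      by (rule bounded_polys_prod)
    then show ?thesis by (simp add: bounded_polys_def T_def monom_fun_def)
  qed
  have "card T \<le> Suc (k * (N * D)) ^ r"
    unfolding T_def using card_image_le[OF finite_exponents] by (metis card_exponents)
  also have "\<dots> \<le> (Suc (k * D) * Suc N) ^ r"
    by (intro power_mono) (auto simp: algebra_simps)
  also have "\<dots> = N * Suc N ^ r"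
    by (simp only: power_mult_distrib N_def[symmetric])
  also have "\<dots> < Suc N ^ Suc r"
    by simp
  also have "\<dots> \<le> Suc N ^ k"
    using \<open>r < k\<close> by (intro power_increasing) auto
  finally have "card T < card (exponents k N)"
    by (simp add: card_exponents)
  moreover have "finite T"
    by (simp add: T_def finite_exponents)
  ultimately obtain c where c: "\<exists>\<alpha>\<in>exponents k N. c \<alpha> \<noteq> 0"
    "\<And>t. (\<Sum>\<alpha>\<in>exponents k N. c \<alpha> * monom_fun k u \<alpha> (\<phi> t)) = 0"
    using exists_linear_relation[of "exponents k N" T "\<lambda>\<alpha> t. monom_fun k u \<alpha> (\<phi> t)"]
      finite_exponents mem by blast
  \<comment> \<open>The relation among the pullbacks is a regular function vanishing on the image of
    \<open>\<phi>\<close>, hence on its closure and on \<open>C k\<close>, where independence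
    applies.\<close>
  let ?F = "\<lambda>p. \<Sum>\<alpha>\<in>exponents k N. c \<alpha> * monom_fun k u \<alpha> p"
  have F: "?F \<in> poly_fun n"
    unfolding monom_fun_def using u(1)
    by (intro function_algebra.sum_mem[OF function_algebra_poly_fun] poly_fun.mult poly_fun.const
        poly_fun_prod poly_fun_power) auto
  have F0: "?F p = 0" if "p \<in> C k" for p
  proof -
    have "\<forall>f\<in>poly_fun n. (\<forall>s\<in>range \<phi>. f s = 0) \<longrightarrow> f p = 0"
      using that Ck unfolding zariski_closure_eq[OF \<phi>] by blast
    from bspec[OF this F] show ?thesis using c(2) by simp
  qed
  have "c \<alpha> = 0" if "\<alpha> \<in> exponents k N" for \<alpha>
  proof (rule chain_monomials_independent[where k = k and j = k and n = n and C = C and u = u and N = N and c = c])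
    show "C i \<subseteq> C (Suc i)" if "i < k" for i using sub[OF that] by blast
  qed (use irr u that F0 in auto)
  then show False using c(1) by blast
qed


section \<open>Upper bound: decompositions with normalised right component\<close>

section \<open>Decomposable polynomials\<close>

text \<open>For \<open>m > 0\<close> there are \<open>e + m\<close> parameters: \<open>t 0\<close>,
  ..., \<open>t e\<close> for the left component and \<open>t (e + 1)\<close>, ...,
  \<open>t (e + m - 1)\<close> for the right one, which is monic without constant term.\<close>

definition comp_param :: "nat \<Rightarrow> nat \<Rightarrow> (nat \<Rightarrow> 'a::comm_ring_1) \<Rightarrow> 'a poly" where
  "comp_param e m t =
     pcompose (\<Sum>i\<le>e. monom (t i) i) (monom 1 m + (\<Sum>j\<in>{1..<m}. monom (t (e + j)) j))"

lemma degree_comp_param_le: "degree (comp_param e m t) \<le> e * m"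
proof -
  have "degree (\<Sum>i\<le>e. monom (t i) i) \<le> e"
    by (intro degree_sum_le) (auto intro: order_trans[OF degree_monom_le])
  moreover have "degree (monom 1 m + (\<Sum>j\<in>{1..<m}. monom (t (e + j)) j)) \<le> m"
    by (intro degree_add_le degree_monom_le degree_sum_le) (auto intro: order_trans[OF degree_monom_le])
  ultimately show ?thesis
    unfolding comp_param_def by (intro order_trans[OF degree_pcompose_le] mult_mono) auto
qed

lemma coeff_comp_param:
  fixes i :: nat
  assumes "m > 0"
  shows "(\<lambda>t. coeff (comp_param e m t) i) \<in> (\<Union>N. bounded_polys (e + m) N :: ((nat \<Rightarrow> 'a::field) \<Rightarrow> 'a) set)"
proof -
  let ?R = "\<Union>N. bounded_polys (e + m) N :: ((nat \<Rightarrow> 'a) \<Rightarrow> 'a) set"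
  interpret function_algebra ?R by (rule function_algebra_bounded_polys)
  have coord: "(\<lambda>t. t j) \<in> ?R" if "j < e + m" for j
    using coordinate_mem_bounded_polys[OF that] by blast
  have monom_mem: "(\<lambda>t. coeff (monom (t j) k) i) \<in> ?R" if "j < e + m" for j k i
    using coord[OF that] const_mem[of 0] by (cases "k = i") auto
  show ?thesis
    unfolding comp_param_def
  proof (rule coeff_pcompose_mem)
    show "degree (\<Sum>i\<le>e. monom (t i) i) \<le> e" for t :: "nat \<Rightarrow> 'a"
      by (intro degree_sum_le) (auto intro: order_trans[OF degree_monom_le])
    show "(\<lambda>t. coeff (\<Sum>j\<le>e. monom (t j) j) i) \<in> ?R" for i
      using assms by (intro coeff_sum_mem monom_mem) auto
    show "(\<lambda>t. coeff (monom 1 m + (\<Sum>j\<in>{1..<m}. monom (t (e + j)) j)) i) \<in> ?R" for i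
      by (rule coeff_add_mem, rule const_mem) (intro coeff_sum_mem monom_mem, auto)
  qed
qed

text \<open>Write \<open>h\<close> as a linear polynomial \<open>[:c, a:]\<close> composed with a
  monic polynomial without constant term, and absorb the linear one into \<open>g\<close>.\<close>

lemma monic_normalisation:
  fixes g h :: "'a::field poly"
  assumes "degree h > 0"
  shows "pcompose g h \<in> range (comp_param (degree g) (degree h))"
proof -
  define a c where "a = lead_coeff h" and "c = coeff h 0"
  define h' where "h' = smult (inverse a) (h - [:c:])"
  define g' where "g' = pcompose g [:c, a:]"
  have "a \<noteq> 0" using assms by (auto simp: a_def)
  then have "pcompose [:c, a:] h' = h"
    by (simp add: h'_def pcompose_pCons)
  then have 1: "pcompose g h = pcompose g' h'"
    by (simp add: g'_def flip: pcompose_assoc)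
  have "degree g' = degree g"
    using \<open>a \<noteq> 0\<close> by (simp add: g'_def degree_pcompose)
  \<comment> \<open>The right component reads the indices \<open>degree g + j\<close> with
    \<open>j >= 1\<close>, so the two blocks do not overlap.\<close>
  define t where "t i = (if i \<le> degree g then coeff g' i else coeff h' (i - degree g))" for i
  have g': "(\<Sum>i\<le>degree g. monom (t i) i) = g'"
    using poly_as_sum_of_monoms[of g'] \<open>degree g' = degree g\<close> by (simp add: t_def)
  have coeff_h': "coeff h' 0 = 0" "\<And>i. i > 0 \<Longrightarrow> coeff h' i = inverse a * coeff h i"
    by (auto simp: h'_def c_def coeff_pCons split: nat.split)
  then have "coeff h' (degree h) = 1"
    using assms \<open>a \<noteq> 0\<close> by (simp flip: a_def)
  have h': "monom 1 (degree h) + (\<Sum>j\<in>{1..<degree h}. monom (t (degree g + j)) j) = h'"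
  proof (rule poly_eqI)
    fix i
    consider "i = 0" | "0 < i" "i < degree h" | "i = degree h" | "i > degree h" by linarith
    then show "coeff (monom 1 (degree h) + (\<Sum>j\<in>{1..<degree h}. monom (t (degree g + j)) j)) i = coeff h' i"
      using assms \<open>coeff h' (degree h) = 1\<close>
      by cases (auto simp: coeff_sum sum.delta t_def coeff_h' coeff_eq_0)
  qed
  show ?thesis
    unfolding 1 using g' h' by (intro range_eqI[of _ _ t]) (simp add: comp_param_def)
qed

text \<open>Degrees multiply under composition, so the left degree is a divisor other than
  \<open>1\<close> and \<open>d\<close>. A prime \<open>d\<close> has none, which gives
  \<open>decomp_set_prime\<close>.\<close>

lemma decomp_set_subset_comp_param:
  "(decomp_set d :: 'a::field poly set) \<subseteq>
     (\<Union>e\<in>{e. e dvd d \<and> 1 < e \<and> e < d}. range (comp_param e (d div e)))"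
proof
  fix f :: "'a poly" assume "f \<in> decomp_set d"
  then obtain g h where gh: "degree g \<ge> 2" "degree h \<ge> 2" "f = pcompose g h" "degree f = d"
    by (auto simp: decomp_set_def decomposable_def)
  then have d: "d = degree g * degree h" by (simp add: degree_pcompose)
  then have "degree g \<in> {e. e dvd d \<and> 1 < e \<and> e < d}" "d div degree g = degree h"
    using gh(1,2) by auto
  then show "f \<in> (\<Union>e\<in>{e. e dvd d \<and> 1 < e \<and> e < d}. range (comp_param e (d div e)))"
    using monic_normalisation[of h g] gh by fastforce
qed

text \<open>Finitely many closed sets cover the closure. The irreducible top of a chain lies in one
  of them, and there the parameter count bounds the length.\<close>

lemma zariski_dim_decomp_set_le:
  assumes "\<And>e. e dvd d \<Longrightarrow> 1 < e \<Longrightarrow> e < d \<Longrightarrow> e + d div e \<le> r"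
  shows "zariski_dim d (decomp_set d :: 'a::field poly set) \<le> enat r"
  unfolding zariski_dim_def
proof (rule Sup_least, clarify)
  fix k and C :: "nat \<Rightarrow> 'a poly set"
  assume irr: "\<forall>i\<le>k. zariski_irreducible d (C i)" and sub: "\<forall>i<k. C i \<subset> C (Suc i)"
    and Ck: "C k \<subseteq> zariski_closure d (decomp_set d)"
  define E where "E = {e. e dvd d \<and> 1 < e \<and> e < d}"
  define Y :: "nat \<Rightarrow> 'a poly set" where "Y e = range (comp_param e (d div e))" for e
  have Y_affine: "Y e \<subseteq> affine_space d" if "e \<in> E" for e
    using that degree_comp_param_le[of e "d div e"] by (auto simp: E_def Y_def affine_space_def)
  have "finite E" by (simp add: E_def)
  have closed: "zariski_closed d (zariski_closure d (Y e))" if "e \<in> E" for e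
    using Y_affine[OF that] by (rule zariski_closed_closure)
  have "zariski_closure d (decomp_set d) \<subseteq> (\<Union>e\<in>E. zariski_closure d (Y e))"
  proof (rule zariski_closure_minimal)
    show "zariski_closed d (\<Union>e\<in>E. zariski_closure d (Y e))"
      using \<open>finite E\<close> closed by (rule zariski_closed_UN)
    show "decomp_set d \<subseteq> (\<Union>e\<in>E. zariski_closure d (Y e))"
      using decomp_set_subset_comp_param[of d] subset_zariski_closure unfolding E_def Y_def
      by (rule order_trans[OF _ UN_mono[OF order_refl]])
  qed
  then have "C k \<subseteq> (\<Union>e\<in>E. zariski_closure d (Y e))"
    using Ck by (rule order_trans[rotated])
  moreover have "zariski_irreducible d (C k)" using irr by simp
  ultimately obtain e where e: "e \<in> E" "C k \<subseteq> zariski_closure d (Y e)"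
    using zariski_irreducible_UN[of d "C k" E "\<lambda>e. zariski_closure d (Y e)"] \<open>finite E\<close> closed by metis
  have "d div e > 0" using e(1) by (auto simp: E_def div_greater_zero_iff)
  have "k \<le> e + d div e"
  proof (rule irreducible_chain_length_le)
    show "C k \<subseteq> zariski_closure d (range (comp_param e (d div e)))"
      using e(2) by (simp add: Y_def)
    show "range (comp_param e (d div e) :: (nat \<Rightarrow> 'a) \<Rightarrow> _) \<subseteq> affine_space d"
      using Y_affine[OF e(1)] by (simp add: Y_def)
  qed (use irr sub coeff_comp_param[OF \<open>d div e > 0\<close>] in auto)
  then show "enat k \<le> enat r"
    using assms[of e] e(1) by (simp add: E_def)
qed

section \<open>Lower bound: an explicit chain of irreducible sets\<close>

text \<open>The two cases match up because \<^term>\<open>pcompose g h\<close> with \<^term>\<open>degree g \<le> 1\<close> and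
  \<^term>\<open>degree h \<le> m\<close> is just an arbitrary polynomial of degree at most \<^term>\<open>m\<close>.\<close>
definition comp_chain :: "nat \<Rightarrow> nat \<Rightarrow> 'a::comm_ring_1 poly set" where
  "comp_chain m k = (if k \<le> m then {p. \<forall>i\<ge>k. coeff p i = 0}
     else {pcompose g h | g h. degree g \<le> k - m \<and> degree h \<le> m})"

lemma pcompose_monom_1: "pcompose (monom 1 k) q = q ^ k"
  by (induction k) (simp_all add: monom_Suc pcompose_pCons pcompose_1 flip: one_pCons)

lemma comp_chain_subset_affine:
  assumes "k \<le> l + m" "l > 0"
  shows "comp_chain m k \<subseteq> affine_space (l * m)"
proof (cases "k \<le> m")
  case True
  then have "k \<le> Suc (l * m)" using assms(2) by (cases l) auto
  then show ?thesis
    using True by (auto simp: comp_chain_def affine_space_def intro!: degree_le)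
next
  case False
  have "degree (pcompose g h) \<le> l * m" if "degree g \<le> k - m" "degree h \<le> m" for g h :: "'a poly"
    using that assms by (intro order_trans[OF degree_pcompose_le] mult_mono) auto
  then show ?thesis
    using False by (auto simp: comp_chain_def affine_space_def)
qed

lemma comp_chain_Suc_mono: "comp_chain m k \<subseteq> comp_chain m (Suc k)"
proof -
  consider "Suc k \<le> m" | "k = m" | "k > m" by linarith
  then show ?thesis
  proof cases
    case 2
    \<comment> \<open>Where the two cases of the definition meet, the identity
      \<open>[:0, 1:]\<close> serves as left component.\<close>
    have "\<exists>g h. p = pcompose g h \<and> degree g \<le> 1 \<and> degree h \<le> m"
      if "\<forall>i\<ge>m. coeff p i = 0" for p :: "'a poly"
      using that
      by (intro exI[of _ "[:0, 1:]"] exI[of _ p]) (auto simp: pcompose_pCons intro!: degree_le)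
    then show ?thesis using 2 by (auto simp: comp_chain_def)
  next
    case 3
    have "degree g \<le> Suc k - m" if "degree g \<le> k - m" for g :: "'a poly"
      using that by simp
    then show ?thesis using 3 by (fastforce simp: comp_chain_def)
  qed (auto simp: comp_chain_def)
qed

text \<open>For \<open>k < m\<close> the new monomial has degree \<open>k\<close>. From
  \<open>k = m\<close> on it is the power \<open>Suc k - m\<close> of \<open>monom 1 m\<close>,
  whose degree exceeds all degrees in the preceding set.\<close>

lemma comp_chain_separated:
  assumes "m > 0"
  obtains c where "\<And>p :: 'a::comm_ring_1 poly. p \<in> comp_chain m k \<Longrightarrow> coeff p c = 0"
    "monom (1::'a) c \<in> comp_chain m (Suc k)"
proof (cases "k < m")
  case True
  then show ?thesis by (intro that[of k]) (auto simp: comp_chain_def)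
next
  case False
  define c where "c = m * (Suc k - m)"
  show ?thesis
  proof (rule that[of c])
    have "monom 1 c = (pcompose (monom 1 (Suc k - m)) (monom 1 m) :: 'a poly)"
      by (simp add: pcompose_monom_1 monom_power c_def)
    then show "monom (1::'a) c \<in> comp_chain m (Suc k)"
      using False unfolding comp_chain_def by (auto intro!: exI degree_monom_le)
    fix p :: "'a poly" assume p: "p \<in> comp_chain m k"
    show "coeff p c = 0"
    \<comment> \<open>At \<open>k = m\<close> the preceding set still consists of the polynomials of
      degree below \<open>m\<close>, and \<open>c = m\<close>.\<close>
    proof (cases "k = m")
      case True
      then show ?thesis using p by (simp add: comp_chain_def c_def)
    next
      case k: False
      then obtain g h where gh: "p = pcompose g h" "degree g \<le> k - m" "degree h \<le> m"
        using p False by (auto simp: comp_chain_def)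
      then have "degree p \<le> (k - m) * m"
        by (auto intro!: order_trans[OF degree_pcompose_le] mult_mono)
      also have "\<dots> < c"
        using False assms by (simp add: c_def Suc_diff_le)
      finally show ?thesis by (rule coeff_eq_0)
    qed
  qed
qed

lemma degree_line_le:
  "degree p \<le> n \<Longrightarrow> degree q \<le> n \<Longrightarrow> degree (p + smult t q) \<le> n"
  by (intro degree_add_le order_trans[OF degree_smult_le])

text \<open>Both components can move along straight lines at once, because the set imposes only
  upper bounds on their degrees.\<close>

lemma comp_chain_connected:
  assumes "v \<in> comp_chain m k" "w \<in> comp_chain m k"
  shows "\<exists>\<gamma>. poly_curve \<gamma> \<and> \<gamma> 0 = v \<and> \<gamma> 1 = w \<and> (\<forall>t. \<gamma> t \<in> comp_chain m k)"
proof (cases "k \<le> m")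
  case True
  then show ?thesis
    using assms poly_curve_line[of v "w - v"]
    by (intro exI[of _ "\<lambda>t. v + smult t (w - v)"]) (auto simp: comp_chain_def)
next
  case False
  obtain g h where v: "v = pcompose g h" "degree g \<le> k - m" "degree h \<le> m"
    using assms(1) False by (auto simp: comp_chain_def)
  obtain g' h' where w: "w = pcompose g' h'" "degree g' \<le> k - m" "degree h' \<le> m"
    using assms(2) False by (auto simp: comp_chain_def)
  let ?g = "\<lambda>t. g + smult t (g' - g)" and ?h = "\<lambda>t. h + smult t (h' - h)"
  have deg: "degree (?g t) \<le> k - m" "degree (?h t) \<le> m" for t
    using v w by (auto intro!: degree_line_le degree_diff_le)
  have "poly_curve (\<lambda>t. pcompose (?g t) (?h t))"
    by (rule poly_curve_pcompose[OF poly_curve_line poly_curve_line deg(1)])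
  then show ?thesis
    using False v(1) w(1) deg by (intro exI[of _ "\<lambda>t. pcompose (?g t) (?h t)"]) (auto simp: comp_chain_def)
qed

text \<open>Adding \<open>t\<close> times a top monomial to both components gives exact degrees
  \<open>l\<close> and \<open>m\<close> for all but at most two \<open>t\<close>. A regular function
  vanishing on \<open>decomp_set (l * m)\<close> therefore vanishes along the whole curve, including
  \<open>t = 0\<close>.\<close>

lemma comp_chain_subset_closure_decomp_set:
  fixes l m :: nat
  assumes inf: "infinite (UNIV :: 'a::field set)" and lm: "l \<ge> 2" "m \<ge> 2"
  shows "(comp_chain m (l + m) :: 'a poly set) \<subseteq> zariski_closure (l * m) (decomp_set (l * m))"
proof
  fix p :: "'a poly" assume p: "p \<in> comp_chain m (l + m)"
  then obtain g h where gh: "p = pcompose g h" "degree g \<le> l" "degree h \<le> m"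
    using lm by (auto simp: comp_chain_def)
  let ?g = "\<lambda>t. g + smult t (monom 1 l)" and ?h = "\<lambda>t. h + smult t (monom 1 m)"
  \<comment> \<open>The parameters at which the coefficient of degree \<open>l\<close> or
    \<open>m\<close> cancels.\<close>
  let ?E = "{- coeff g l, - coeff h m}"
  have deg_le: "degree (?g t) \<le> l" "degree (?h t) \<le> m" for t
    using gh by (auto intro!: degree_line_le degree_monom_le)
  have curve: "poly_curve (\<lambda>t. pcompose (?g t) (?h t))"
    by (rule poly_curve_pcompose[OF poly_curve_line poly_curve_line deg_le(1)])
  have mem: "pcompose (?g t) (?h t) \<in> decomp_set (l * m)" if "t \<notin> ?E" for t
  proof -
    have "coeff (?g t) l \<noteq> 0" "coeff (?h t) m \<noteq> 0"
      using that by (auto simp: add_eq_0_iff2)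
    then have "degree (?g t) = l" "degree (?h t) = m"
      using deg_le by (auto intro!: antisym le_degree)
    then have "decomposable (pcompose (?g t) (?h t))"
      unfolding decomposable_def using lm by (intro exI[of _ "?g t"] exI[of _ "?h t"]) simp
    then show ?thesis
      using \<open>degree (?g t) = l\<close> \<open>degree (?h t) = m\<close> by (simp add: decomp_set_def degree_pcompose)
  qed
  have "f p = 0" if f: "f \<in> poly_fun (l * m)" "\<forall>s\<in>decomp_set (l * m). f s = 0" for f
  proof -
    obtain q where q: "\<And>t. f (pcompose (?g t) (?h t)) = poly q t"
      using poly_curve_poly_fun[OF curve f(1)] by blast
    have "q = 0"
      using mem f(2) by (intro poly_eq_0_if_cofinitely_zero[OF inf, of ?E]) (auto simp flip: q)
    then show ?thesis using q[of 0] gh(1) by simp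
  qed
  moreover have "p \<in> affine_space (l * m)"
    using comp_chain_subset_affine[of "l + m" l m] lm p by auto
  ultimately show "p \<in> zariski_closure (l * m) (decomp_set (l * m))"
    by (subst zariski_closure_eq) (auto simp: decomp_set_def affine_space_def)
qed

text \<open>The closures of \<open>comp_chain m 0\<close>, ..., \<open>comp_chain m (l + m)\<close>
  form a chain with \<open>l + m\<close> strict steps.\<close>

lemma zariski_dim_decomp_set_ge:
  fixes l m :: nat
  assumes inf: "infinite (UNIV :: 'a::field set)" and lm: "l \<ge> 2" "m \<ge> 2"
  shows "enat (l + m) \<le> zariski_dim (l * m) (decomp_set (l * m) :: 'a poly set)"
  unfolding zariski_dim_def
proof (intro Sup_upper CollectI exI conjI allI impI)
  let ?C = "\<lambda>k. zariski_closure (l * m) (comp_chain m k :: 'a poly set)"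
  have affine: "comp_chain m k \<subseteq> (affine_space (l * m) :: 'a poly set)" if "k \<le> l + m" for k
    using comp_chain_subset_affine[OF that] lm by simp
  show "enat (l + m) = enat (l + m)" ..
  show "zariski_irreducible (l * m) (?C i)" if "i \<le> l + m" for i
  proof (rule zariski_irreducible_closure[OF inf affine[OF that]])
    have "0 \<in> (comp_chain m i :: 'a poly set)"
      by (auto simp: comp_chain_def intro!: exI[of _ 0])
    then show "(comp_chain m i :: 'a poly set) \<noteq> {}" by blast
  qed (rule comp_chain_connected)
  show "?C i \<subset> ?C (Suc i)" if "i < l + m" for i
  proof -
    obtain c where c: "\<And>p :: 'a poly. p \<in> comp_chain m i \<Longrightarrow> coeff p c = 0"
      "monom (1::'a) c \<in> comp_chain m (Suc i)"
      using comp_chain_separated[of m i] lm by auto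
    have "monom (1::'a) c \<in> affine_space (l * m)"
      using affine[of "Suc i"] c(2) that by auto
    then have "(\<lambda>p. coeff p c) \<in> (poly_fun (l * m) :: ('a poly \<Rightarrow> 'a) set)"
      by (intro poly_fun.var) (simp add: affine_space_def degree_monom_eq)
    \<comment> \<open>A coordinate vanishing on the set vanishes on its closure, but it equals
      \<open>1\<close> at this monomial.\<close>
    then have "monom 1 c \<notin> ?C i"
      using c(1) that by (auto simp: zariski_closure_eq[OF affine] intro!: bexI[of _ "\<lambda>p. coeff p c"])
    moreover have "monom 1 c \<in> ?C (Suc i)"
      using c(2) subset_zariski_closure by blast
    moreover have "?C i \<subseteq> ?C (Suc i)"
      using comp_chain_Suc_mono subset_zariski_closure
      by (intro zariski_closure_subset_closure) blast
    ultimately show ?thesis by blast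
  qed
  show "?C (l + m) \<subseteq> zariski_closure (l * m) (decomp_set (l * m))"
    using comp_chain_subset_closure_decomp_set[OF inf lm] by (rule zariski_closure_subset_closure)
qed

section \<open>The optimal divisor and the conclusion\<close>

text \<open>Since \<^term>\<open>e * (d div e) = l * (d div l)\<close>, the claim is
  \<^term>\<open>(e - l) * (d div e - l) \<ge> 0\<close>.\<close>
lemma divisor_sum_le:
  fixes l d e :: nat
  assumes "l > 0" "l dvd d" "e dvd d" "l \<le> e" "l \<le> d div e"
  shows "e + d div e \<le> l + d div l"
proof -
  define m where "m = d div e"
  obtain a b where ab: "e = l + a" "m = l + b"
    using assms(4,5) by (auto simp: m_def le_iff_add)
  have "l * (d div l) = e * m" using assms by (simp add: m_def)
  then have "l * (l + d div l) = l * (e + m) + a * b"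
    by (simp add: ab algebra_simps)
  then have "l * (e + m) \<le> l * (l + d div l)" by simp
  then show ?thesis using assms(1) by (simp add: m_def)
qed

lemma decomp_set_prime: "prime d \<Longrightarrow> (decomp_set d :: 'a::field poly set) = {}"
  using decomp_set_subset_comp_param[of d, where 'a = 'a] by (auto simp: prime_nat_iff)

theorem theorem5p1:
  fixes d :: nat
  assumes "d \<ge> 2"
  defines "l \<equiv> Min {p. prime p \<and> p dvd d}"
  shows "(prime d \<longrightarrow> (decomp_set d :: 'a::alg_closed_field poly set) = {}) \<and>
         (\<not> prime d \<longrightarrow> zariski_dim d (decomp_set d :: 'a poly set) = enat (l + d div l))"
proof (intro conjI impI)
  show "decomp_set d = ({} :: 'a poly set)" if "prime d"
    using that by (rule decomp_set_prime)
  assume "\<not> prime d"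
  have "finite {p. prime p \<and> p dvd d}"
    using assms(1) by (intro finite_subset[OF _ finite_divisors_nat[of d]]) auto
  moreover have "{p. prime p \<and> p dvd d} \<noteq> {}"
    using prime_factor_nat[of d] assms(1) by auto
  ultimately have l: "prime l" "l dvd d" and l_le: "\<And>p. prime p \<Longrightarrow> p dvd d \<Longrightarrow> l \<le> p"
    using Min_in[of "{p. prime p \<and> p dvd d}"] by (auto simp: l_def)
  \<comment> \<open>Every divisor \<open>e > 1\<close> has a prime factor, and that factor is at
    least \<open>l\<close>.\<close>
  have le: "l \<le> e" if "e dvd d" "1 < e" for e
  proof -
    obtain p where "prime p" "p dvd e" using prime_factor_nat[of e] \<open>1 < e\<close> by auto
    then show ?thesis using l_le[of p] that dvd_imp_le[of p e] dvd_trans[of p e d] by linarith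
  qed
  show "zariski_dim d (decomp_set d :: 'a poly set) = enat (l + d div l)"
  proof (rule antisym)
    show "zariski_dim d (decomp_set d :: 'a poly set) \<le> enat (l + d div l)"
    proof (rule zariski_dim_decomp_set_le)
      fix e assume e: "e dvd d" "1 < e" "e < d"
      then obtain m where m: "d = e * m" by auto
      then have "m \<noteq> 0" "m \<noteq> 1" using e by auto
      \<comment> \<open>The cofactor is again a divisor greater than \<open>1\<close>, so
        \<open>le\<close> gives both lower bounds that \<open>divisor_sum_le\<close>
        requires.\<close>
      then have "d div e dvd d" "1 < d div e" using e(2) m by auto
      then show "e + d div e \<le> l + d div l"
        using e l le by (intro divisor_sum_le) (auto simp: prime_gt_0_nat)
    qed
    obtain m where m: "d = l * m" using l(2) by auto
    have "m \<noteq> 0" using assms(1) m by (cases "m = 0") auto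
    moreover have "m \<noteq> 1" using \<open>\<not> prime d\<close> l(1) m by auto
    ultimately have "2 \<le> m" by linarith
    then show "enat (l + d div l) \<le> zariski_dim d (decomp_set d :: 'a poly set)"
      using zariski_dim_decomp_set_ge[OF alg_closed_field_infinite[where 'a = 'a], of l m]
        prime_ge_2_nat[OF l(1)] \<open>2 \<le> m\<close> unfolding m by simp
  qed
qed

end
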